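(* Let $a>0$ be a real number and $k\ge 1$ an integer. Let $d_1,d_2\ge k$ and $t\ge1$ be integers and let $c>0$ be real. Then $$ P\left(|X(d_1,d_2,t)-EX(d_1,d_2,t)|\ge c(d_1+d_2)\sqrt{kt}\right)\le2\exp\left(-\frac{c^2}8\right). $$ In particular, if $c(t)\to\infty$ as $t\to\infty$, then $|X(d_1,d_2,t)-EX(d_1,d_2,t)|<c(t)(d_1+d_2)\sqrt{kt}$ with probability tending to $1$ as $t\to\infty$.
   Context: The Buckley--Osthus random graph. Fix a real number $a>0$ and an integer $k\ge1$ (constants). Graphs are undirected, and loops and multiple edges are allowed; a loop contributes $2$ to the degree of its node. First stage: the random graph $H_{a,1}^{(t)}$ has nodes $1,\dots,t$ and $t$ edges. $H_{a,1}^{(1)}$ is the graph with one node and one loop. For $t\ge2$, $H_{a,1}^{(t)}$ is obtained from $H_{a,1}^{(t-1)}$ by adding a new node $t$ and one new edge between $t$ and a random node $\gamma\in\{1,\dots,t\}$, where, conditionally on the graph $H_{a,1}^{(t-1)}$, $$\Pr(\gamma=s)=\frac{\deg_{t-1}(s)-1+a}{(a+1)t-1}\ \text{ for } 1\le s\le t-1,\qquad \Pr(\gamma=t)=\frac{a}{(a+1)t-1},$$ and $\deg_{t-1}(s)$ is the degree of $s$ in $H_{a,1}^{(t-1)}$. Second stage: $H_{a,k}^{(t)}$ is obtained from $H_{a,1}^{(kt)}$ by identifying the nodes $1,\dots,k$ into one node, the nodes $k+1,\dots,2k$ into a second node, and so on, which gives $t$ nodes; all $kt$ edges are kept (possibly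 becoming multiple edges and multiple loops). $X(d_1,d_2,t)$ is the total number of edges of $H_{a,k}^{(t)}$ linking a node of degree $d_1$ and a node of degree $d_2$; when $d_1=d_2$ every such edge is counted twice, and loops are not counted. That is, $X(d_1,d_2,t)=\sum_{s_1\ne s_2}N(s_1,s_2)$, the sum being over ordered pairs of distinct nodes $(s_1,s_2)$ of $H_{a,k}^{(t)}$ with $\deg s_1=d_1$, $\deg s_2=d_2$, where $N(s_1,s_2)$ is the number of edges between $s_1$ and $s_2$. $P$ and $E$ denote probability and expectation. *)

theory Defs
  imports "HOL-Probability.Probability" "HOL-Library.Multiset"
begin

text \<open>
  A multigraph on a node set \<open>{1..t}\<close> is given by its multiset of edges; an edge is a two-element
  multiset of nodes, so \<open>{#v, v#}\<close> is a loop at \<open>v\<close>.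
\<close>

type_synonym multigraph = "nat multiset multiset"

text \<open>The inner \<open>count\<close> is 2 for a loop at \<open>v\<close>.\<close>

definition deg :: "multigraph \<Rightarrow> nat \<Rightarrow> nat" where
  "deg G v = (\<Sum>e\<in>#G. count e v)"

definition attach_prob :: "real \<Rightarrow> nat \<Rightarrow> multigraph \<Rightarrow> nat \<Rightarrow> real" where
  "attach_prob a t G s =
     (if 1 \<le> s \<and> s \<le> t - 1 then (real (deg G s) - 1 + a) / ((a + 1) * real t - 1)
      else if s = t then a / ((a + 1) * real t - 1)
      else 0)"

text \<open>
  \<open>embed_pmf\<close> is only meaningful if its argument is nonnegative with total mass 1; lemma
  \<open>pmf_attach_pmf\<close> below shows that this holds for every graph that can occur.
\<close>

definition attach_pmf :: "real \<Rightarrow> nat \<Rightarrow> multigraph \<Rightarrow> nat pmf" where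
  "attach_pmf a t G = embed_pmf (attach_prob a t G)"

text \<open>The value at \<open>0\<close> is a dummy.\<close>

fun BO1 :: "real \<Rightarrow> nat \<Rightarrow> multigraph pmf" where
  "BO1 a 0 = return_pmf {#}"
| "BO1 a (Suc 0) = return_pmf {# {#1, 1#} #}"
| "BO1 a (Suc (Suc n)) =
     bind_pmf (BO1 a (Suc n)) (\<lambda>G.
       map_pmf (\<lambda>s. add_mset {#Suc (Suc n), s#} G) (attach_pmf a (Suc (Suc n)) G))"

text \<open>Sends \<open>1, \<dots>, k\<close> to \<open>1\<close>, then \<open>k + 1, \<dots>, 2 * k\<close> to \<open>2\<close>, and so on.\<close>

definition block :: "nat \<Rightarrow> nat \<Rightarrow> nat" where
  "block k i = (i - 1) div k + 1"

definition BO :: "real \<Rightarrow> nat \<Rightarrow> nat \<Rightarrow> multigraph pmf" where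
  "BO a k t = map_pmf (image_mset (image_mset (block k))) (BO1 a (k * t))"

text \<open>
  The sum is over ordered pairs, so for \<open>d1 = d2\<close> every edge is counted twice.
\<close>

definition num_edges :: "nat \<Rightarrow> nat \<Rightarrow> nat \<Rightarrow> multigraph \<Rightarrow> nat" where
  "num_edges d1 d2 t G =
     (\<Sum>(s1, s2) \<in> {(s1, s2). s1 \<in> {1..t} \<and> s2 \<in> {1..t} \<and> s1 \<noteq> s2 \<and>
                             deg G s1 = d1 \<and> deg G s2 = d2}. count G {#s1, s2#})"

definition expected_num_edges :: "real \<Rightarrow> nat \<Rightarrow> nat \<Rightarrow> nat \<Rightarrow> nat \<Rightarrow> real" where
  "expected_num_edges a k d1 d2 t =
     measure_pmf.expectation (BO a k t) (\<lambda>G. real (num_edges d1 d2 t G))"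

definition valid_graph :: "nat \<Rightarrow> multigraph \<Rightarrow> bool" where
  "valid_graph t G \<longleftrightarrow> size G = t \<and> (\<forall>e\<in>#G. size e = 2 \<and> set_mset e \<subseteq> {1..t}) \<and>
     (\<forall>s\<in>{1..t}. deg G s \<ge> 1)"

lemma deg_add_mset: "deg (add_mset e G) v = count e v + deg G v"
  by (simp add: deg_def)

lemma sum_deg:
  assumes "finite V" "\<forall>e\<in>#G. size e = 2 \<and> set_mset e \<subseteq> V"
  shows "(\<Sum>v\<in>V. deg G v) = 2 * size G"
  using assms(2)
proof (induction G)
  case empty
  show ?case by (simp add: deg_def)
next
  case (add e G)
  then have e: "size e = 2" "set_mset e \<subseteq> V" by auto
  have "(\<Sum>v\<in>V. count e v) = (\<Sum>v\<in>set_mset e. count e v)"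
    using e(2) assms(1) by (intro sum.mono_neutral_right) (auto simp: not_in_iff)
  also have "\<dots> = 2" using e(1) by (simp add: size_multiset_overloaded_eq)
  finally show ?case using add by (simp add: deg_add_mset sum.distrib)
qed

lemma pmf_attach_pmf_valid:
  assumes a: "a > 0" and t: "t \<ge> 1" and G: "valid_graph t G"
  shows "pmf (attach_pmf a (Suc t) G) s = attach_prob a (Suc t) G s"
proof -
  let ?f = "attach_prob a (Suc t) G"
  let ?D = "(a + 1) * real (Suc t) - 1"
  have D: "?D > 0" using a by (simp add: algebra_simps add_pos_nonneg)
  have deg: "real (deg G s) \<ge> 1" if "1 \<le> s" "s \<le> t" for s
    using G that by (auto simp: valid_graph_def)
  have nonneg: "?f s \<ge> 0" for s
    using a D deg[of s] by (auto simp: attach_prob_def intro!: divide_nonneg_pos)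
  have outside: "?f s = 0" if "s \<notin> {1..Suc t}" for s
    using that by (auto simp: attach_prob_def)
  have "(\<Sum>s\<in>{1..t}. deg G s) = 2 * t"
    using sum_deg[of "{1..t}" G] G by (simp add: valid_graph_def)
  then have dsum: "(\<Sum>s\<in>{1..t}. real (deg G s)) = 2 * real t"
    by (metis of_nat_mult of_nat_numeral of_nat_sum)
  have "(\<Sum>s\<in>{1..Suc t}. ?f s) =
      (\<Sum>s\<in>{1..t}. (real (deg G s) - 1 + a) / ?D) + a / ?D"
    by (simp add: attach_prob_def)
  also have "\<dots> = ((\<Sum>s\<in>{1..t}. real (deg G s) - 1 + a) + a) / ?D"
    by (simp only: sum_divide_distrib[symmetric] add_divide_distrib[symmetric])
  also have "(\<Sum>s\<in>{1..t}. real (deg G s) - 1 + a) + a = ?D"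
    using dsum by (simp add: sum.distrib sum_subtractf algebra_simps)
  finally have sum1: "(\<Sum>s\<in>{1..Suc t}. ?f s) = 1" using D by simp
  have "(\<integral>\<^sup>+ s. ennreal (?f s) \<partial>count_space UNIV) = (\<Sum>s\<in>{1..Suc t}. ennreal (?f s))"
    using outside by (intro nn_integral_count_space'[of "{1..Suc t}"]) auto
  also have "\<dots> = 1" using nonneg sum1 by (simp add: sum_ennreal del: sum.cl_ivl_Suc)
  finally show ?thesis unfolding attach_pmf_def by (intro pmf_embed_pmf nonneg)
qed

lemma set_pmf_BO1:
  assumes "a > 0" "t \<ge> 1" "G \<in> set_pmf (BO1 a t)"
  shows "valid_graph t G"
  using assms(2,3)
proof (induction t arbitrary: G rule: nat_induct_at_least)
  case base
  then show ?case by (auto simp: valid_graph_def deg_def)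
next
  case (Suc n)
  then obtain m where m: "n = Suc m" by (cases n) auto
  from Suc.prems m obtain H s where H: "H \<in> set_pmf (BO1 a n)"
    and s: "s \<in> set_pmf (attach_pmf a (Suc n) H)" and G: "G = add_mset {#Suc n, s#} H"
    by auto
  have v: "valid_graph n H" using Suc.IH H by auto
  have "attach_prob a (Suc n) H s \<noteq> 0"
    using s pmf_attach_pmf_valid[OF assms(1) Suc.hyps v, of s] by (simp add: set_pmf_iff)
  then have "s \<in> {1..Suc n}" by (auto simp: attach_prob_def split: if_splits)
  moreover have "set_mset e \<subseteq> {1..Suc n}" if "e \<in># H" for e
  proof -
    have "set_mset e \<subseteq> {1..n}" using v that by (auto simp: valid_graph_def)
    then show ?thesis by fastforce
  qed
  moreover have "deg G j \<ge> 1" if "j \<in> {1..Suc n}" for j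
    using v that by (cases "j = Suc n") (auto simp: G valid_graph_def deg_add_mset le_Suc_eq)
  ultimately show ?case using v by (auto simp: valid_graph_def G)
qed

lemma pmf_attach_pmf:
  assumes "a > 0" "t \<ge> 2" "G \<in> set_pmf (BO1 a (t - 1))"
  shows "pmf (attach_pmf a t G) s = attach_prob a t G s"
  using pmf_attach_pmf_valid[of a "t - 1" G s] set_pmf_BO1[of a "t - 1" G] assms by simp

end

theory Submission imports Defs begin

text \<open>
  Fix the graph \<open>H\<close> before some step and compare two choices \<open>s\<close>, \<open>s'\<close> of the node that the new
  edge is attached to. The two continuations can be coupled so that at all later times they differ
  only in that some edge ends sit at \<open>s\<close> in one graph and at \<open>s'\<close> in the other: the attachment
  probabilities differ at \<open>s\<close> and \<open>s'\<close> only, and the surplus mass at \<open>s\<close> is moved to \<open>s'\<close>.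
  Identifying nodes preserves this relation. The counted edges that touch the node of \<open>s\<close> or of \<open>s'\<close>
  number between 0 and \<open>2 * (d1 + d2)\<close> in each graph, and all others are common, so the two counts
  differ by at most \<open>2 * (d1 + d2)\<close>. Hence, given the past, each increment of the Doob martingale
  of the count lies in an interval of this length; Hoeffding's lemma and the Chernoff bound give
  the tail \<open>2 * exp (- c\<^sup>2 / 2)\<close>.
\<close>

section \<open>Coupling two distributions by moving mass\<close>

lemma pmf_eqI_except_point:
  assumes "\<And>x. x \<noteq> s \<Longrightarrow> pmf p x = pmf q x"
  shows "p = q"
proof (rule pmf_eqI)
  have eq: "measure p (- {s}) = measure q (- {s})"
    unfolding measure_pmf_conv_infsetsum by (rule infsetsum_cong) (auto simp: assms)
  have "pmf p s = pmf q s"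
    using eq measure_pmf.prob_compl[of "{s}" p] measure_pmf.prob_compl[of "{s}" q]
    by (simp add: measure_pmf_single Compl_eq_Diff_UNIV)
  then show "pmf p x = pmf q x" for x
    using assms by (cases "x = s") auto
qed

text \<open>Draw \<open>x\<close> from \<open>p\<close>; if \<open>x = s\<close>, keep it with
  probability \<open>pmf q s / pmf p s\<close> and replace it by \<open>s'\<close> otherwise. The
  result has the mass of \<open>q\<close> everywhere except perhaps at \<open>s'\<close>, and there
  total mass 1 forces agreement.\<close>

lemma rel_pmf_move_mass:
  assumes eq: "\<And>x. x \<noteq> s \<Longrightarrow> x \<noteq> s' \<Longrightarrow> pmf p x = pmf q x"
    and le: "pmf q s \<le> pmf p s"
  shows "rel_pmf (\<lambda>x y. x = y \<or> (x = s \<and> y = s')) p q"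
proof (cases "s = s'")
  case True
  then have "p = q" using eq by (intro pmf_eqI_except_point) auto
  then show ?thesis by (auto intro: rel_pmf_reflI)
next
  case False
  \<comment> \<open>If \<open>pmf p s = 0\<close>, the quotient is 0; then
    \<open>pmf q s = 0\<close> too, so \<open>r * pmf p s = pmf q s\<close> holds in every
    case.\<close>
  define r where "r = pmf q s / pmf p s"
  have r: "0 \<le> r" "r \<le> 1" using le by (auto simp: r_def divide_le_eq_1 pmf_nonneg less_le)
  define h where
    "h x = (if x = s then map_pmf (\<lambda>b. if b then s else s') (bernoulli_pmf r) else return_pmf x)" for x
  have h_s: "pmf (h y) s = r * indicator {s} y" for y
  proof -
    have "(\<lambda>b. if b then s else s') -` {s} = {True}" using False by (auto split: if_splits)
    then show ?thesis using r by (auto simp: h_def pmf_map measure_pmf_single)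
  qed
  have h_other: "pmf (h y) x = indicator {x} y" if "x \<noteq> s" "x \<noteq> s'" for x y
  proof -
    have "(\<lambda>b. if b then s else s') -` {x} = {}" using that by (auto split: if_splits)
    then show ?thesis using that by (auto simp: h_def pmf_map indicator_def)
  qed
  have "bind_pmf p h = q"
  proof (rule pmf_eqI_except_point)
    fix x assume "x \<noteq> s'"
    show "pmf (bind_pmf p h) x = pmf q x"
    proof (cases "x = s")
      case True
      then have "pmf (bind_pmf p h) x = r * pmf p s"
        by (simp add: pmf_bind h_s measure_pmf_single)
      also have "\<dots> = pmf q s" using le pmf_nonneg[of q s] by (auto simp: r_def)
      finally show ?thesis using True by simp
    next
      case False
      then show ?thesis using \<open>x \<noteq> s'\<close> eq
        by (simp add: pmf_bind h_other measure_pmf_single)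
    qed
  qed
  \<comment> \<open>Writing \<open>p\<close> as a bind over itself makes both sides start from the
    same draw, which is coupled diagonally; only the second stage differs.\<close>
  moreover have "rel_pmf (\<lambda>x y. x = y \<or> (x = s \<and> y = s')) (bind_pmf p return_pmf) (bind_pmf p h)"
    by (rule rel_pmf_bindI[where R = "(=)"])
       (auto simp: rel_pmf_return_pmf1 h_def intro: rel_pmf_reflI split: if_splits)
  ultimately show ?thesis by (simp add: bind_return_pmf')
qed

lemma abs_expectation_diff_le_rel_pmf:
  fixes f :: "'a \<Rightarrow> real"
  assumes rel: "rel_pmf R p q" and fin: "finite (set_pmf p)" "finite (set_pmf q)"
    and diff: "\<And>x y. x \<in> set_pmf p \<Longrightarrow> y \<in> set_pmf q \<Longrightarrow> R x y \<Longrightarrow> \<bar>f x - f y\<bar> \<le> M"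
  shows "\<bar>measure_pmf.expectation p f - measure_pmf.expectation q f\<bar> \<le> M"
proof -
  from rel obtain pq where R: "\<And>x y. (x, y) \<in> set_pmf pq \<Longrightarrow> R x y"
    and p: "map_pmf fst pq = p" and q: "map_pmf snd pq = q"
    by (auto elim: rel_pmf.cases)
  have sub: "set_pmf pq \<subseteq> set_pmf p \<times> set_pmf q"
    by (force simp: p[symmetric] q[symmetric])
  then have "finite (set_pmf pq)" using fin by (meson finite_SigmaI finite_subset)
  then have int: "integrable pq g" for g :: "'a \<times> 'a \<Rightarrow> real"
    by (rule integrable_measure_pmf_finite)
  have "measure_pmf.expectation p f - measure_pmf.expectation q f
      = measure_pmf.expectation pq (\<lambda>z. f (fst z) - f (snd z))"
    by (simp add: p[symmetric] q[symmetric] int)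
  also have "\<bar>\<dots>\<bar> \<le> measure_pmf.expectation pq (\<lambda>z. \<bar>f (fst z) - f (snd z)\<bar>)"
    by (rule integral_abs_bound)
  also have "\<dots> \<le> measure_pmf.expectation pq (\<lambda>z. M)"
    using sub R by (intro integral_mono_AE int) (auto simp: AE_measure_pmf_iff intro!: diff)
  finally show ?thesis by simp
qed

section \<open>Exponential moments and tails of a coupled Markov chain\<close>

text \<open>Hoeffding's lemma on the interval from the least to the greatest value of
  \<open>f\<close> on the support. Its length is at most \<open>M\<close>; using only that
  \<open>f\<close> stays within \<open>M\<close> of its mean would give length \<open>2 * M\<close>
  and a fourfold exponent.\<close>

lemma expectation_exp_le_oscillation:
  fixes f :: "'a \<Rightarrow> real"
  assumes fin: "finite (set_pmf p)" and l: "l > 0"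
    and osc: "\<And>x y. x \<in> set_pmf p \<Longrightarrow> y \<in> set_pmf p \<Longrightarrow> \<bar>f x - f y\<bar> \<le> M"
  shows "measure_pmf.expectation p (\<lambda>x. exp (l * (f x - measure_pmf.expectation p f)))
           \<le> exp (l\<^sup>2 * M\<^sup>2 / 8)"
proof -
  define u v where "u = Min (f ` set_pmf p)" and "v = Max (f ` set_pmf p)"
  have ne: "f ` set_pmf p \<noteq> {}" by (simp add: set_pmf_not_empty)
  interpret interval_bounded_random_variable "measure_pmf p" f u v
    by unfold_locales (auto simp: AE_measure_pmf_iff u_def v_def fin)
  have "u \<in> f ` set_pmf p" "v \<in> f ` set_pmf p"
    using fin ne unfolding u_def v_def by (auto intro: Min_in Max_in simp del: Min_in Max_in)
  then have "\<bar>v - u\<bar> \<le> M" using osc by auto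
  then have vu: "(v - u)\<^sup>2 \<le> M\<^sup>2" by (simp add: abs_le_square_iff[symmetric])
  have "ennreal (measure_pmf.expectation p (\<lambda>x. exp (l * (f x - measure_pmf.expectation p f))))
      = (\<integral>\<^sup>+x. ennreal (exp (l * (f x - measure_pmf.expectation p f))) \<partial>p)"
    by (intro nn_integral_eq_integral[symmetric] integrable_measure_pmf_finite fin) auto
  also have "\<dots> \<le> ennreal (exp (l\<^sup>2 * (v - u)\<^sup>2 / 8))"
    using Hoeffdings_lemma_nn_integral[OF l] by simp
  finally have "measure_pmf.expectation p (\<lambda>x. exp (l * (f x - measure_pmf.expectation p f)))
      \<le> exp (l\<^sup>2 * (v - u)\<^sup>2 / 8)"
    by simp
  also have "\<dots> \<le> exp (l\<^sup>2 * M\<^sup>2 / 8)"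
    using vu by (simp add: mult_left_mono)
  finally show ?thesis .
qed

lemma expectation_bind_pmf_finite:
  fixes f :: "'b \<Rightarrow> real"
  assumes "finite (set_pmf p)" "\<And>x. x \<in> set_pmf p \<Longrightarrow> finite (set_pmf (K x))"
  shows "measure_pmf.expectation (bind_pmf p K) f
           = measure_pmf.expectation p (\<lambda>x. measure_pmf.expectation (K x) f)"
  using assms by (subst pmf_expectation_bind[of "set_pmf p"])
    (auto simp: integral_measure_pmf[of "set_pmf p"])

text \<open>Two outcomes of the same step are related (\<open>branch\<close>), and related states
  have continuations that can be kept related (\<open>couple\<close>). So if \<open>f\<close> varies
  by at most \<open>M\<close> over related states, its conditional expectations after two outcomes
  of a step also differ by at most \<open>M\<close>.\<close>

locale coupled_chain =
  fixes \<mu> :: "nat \<Rightarrow> 'a pmf" and x0 :: 'a and K :: "nat \<Rightarrow> 'a \<Rightarrow> 'a pmf"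
    and R :: "'a \<Rightarrow> 'a \<Rightarrow> bool"
  assumes start: "\<mu> 0 = return_pmf x0"
    and step: "\<mu> (Suc n) = bind_pmf (\<mu> n) (K n)"
    and finite_step: "x \<in> set_pmf (\<mu> n) \<Longrightarrow> finite (set_pmf (K n x))"
    and couple: "\<lbrakk>x \<in> set_pmf (\<mu> n); y \<in> set_pmf (\<mu> n); R x y\<rbrakk> \<Longrightarrow> rel_pmf R (K n x) (K n y)"
    and branch: "\<lbrakk>x \<in> set_pmf (\<mu> n); y \<in> set_pmf (K n x); z \<in> set_pmf (K n x)\<rbrakk> \<Longrightarrow> R y z"
begin

lemma finite_support: "finite (set_pmf (\<mu> n))"
  by (induction n) (auto simp: start step finite_step)

text \<open>The last step is peeled off. The one-step average \<open>g\<close> of \<open>f\<close>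
  again varies by at most \<open>M\<close> over related states, by \<open>couple\<close>, so the
  induction applies to \<open>g\<close>. Given the state before it, the last step contributes a
  factor \<open>exp (l\<^sup>2 * M\<^sup>2 / 8)\<close>, by \<open>branch\<close>.\<close>

lemma expectation_exp_le:
  fixes f :: "'a \<Rightarrow> real"
  assumes "l > 0"
    and "\<And>x y. x \<in> set_pmf (\<mu> n) \<Longrightarrow> y \<in> set_pmf (\<mu> n) \<Longrightarrow> R x y \<Longrightarrow> \<bar>f x - f y\<bar> \<le> M"
  shows "measure_pmf.expectation (\<mu> n) (\<lambda>x. exp (l * (f x - measure_pmf.expectation (\<mu> n) f)))
           \<le> exp (real n * (l\<^sup>2 * M\<^sup>2 / 8))"
  using assms(2)
proof (induction n arbitrary: f)
  case 0
  then show ?case by (simp add: start)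
next
  case (Suc n)
  define g where "g x = measure_pmf.expectation (K n x) f" for x
  let ?m = "measure_pmf.expectation (\<mu> n) g"
  have sub: "y \<in> set_pmf (\<mu> (Suc n))" if "x \<in> set_pmf (\<mu> n)" "y \<in> set_pmf (K n x)" for x y
    using that by (auto simp: step)
  have mean: "measure_pmf.expectation (\<mu> (Suc n)) f = ?m"
    by (simp add: step g_def[abs_def] expectation_bind_pmf_finite finite_support finite_step)
  have IH: "measure_pmf.expectation (\<mu> n) (\<lambda>x. exp (l * (g x - ?m))) \<le> exp (real n * (l\<^sup>2 * M\<^sup>2 / 8))"
    unfolding g_def
    by (rule Suc.IH, rule abs_expectation_diff_le_rel_pmf[OF couple])
       (auto intro: finite_step Suc.prems sub)
  have one: "measure_pmf.expectation (K n x) (\<lambda>y. exp (l * (f y - ?m)))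
      \<le> exp (l\<^sup>2 * M\<^sup>2 / 8) * exp (l * (g x - ?m))" if x: "x \<in> set_pmf (\<mu> n)" for x
  proof -
    \<comment> \<open>The deviation is split at the conditional mean \<open>g x\<close>: the first
      factor is the fluctuation of the last step, the second is constant given
      \<open>x\<close>.\<close>
    have "(\<lambda>y. exp (l * (f y - ?m))) = (\<lambda>y. exp (l * (f y - g x)) * exp (l * (g x - ?m)))"
      by (simp add: exp_add[symmetric] algebra_simps)
    then have "measure_pmf.expectation (K n x) (\<lambda>y. exp (l * (f y - ?m)))
        = measure_pmf.expectation (K n x) (\<lambda>y. exp (l * (f y - g x))) * exp (l * (g x - ?m))"
      by simp
    also have "measure_pmf.expectation (K n x) (\<lambda>y. exp (l * (f y - g x))) \<le> exp (l\<^sup>2 * M\<^sup>2 / 8)"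
      unfolding g_def
      by (rule expectation_exp_le_oscillation[OF finite_step[OF x] \<open>l > 0\<close>])
         (auto intro: Suc.prems sub x branch)
    finally show ?thesis by simp
  qed
  have "measure_pmf.expectation (\<mu> (Suc n)) (\<lambda>y. exp (l * (f y - ?m)))
      = measure_pmf.expectation (\<mu> n) (\<lambda>x. measure_pmf.expectation (K n x) (\<lambda>y. exp (l * (f y - ?m))))"
    by (simp add: step expectation_bind_pmf_finite finite_support finite_step)
  also have "\<dots> \<le> measure_pmf.expectation (\<mu> n) (\<lambda>x. exp (l\<^sup>2 * M\<^sup>2 / 8) * exp (l * (g x - ?m)))"
    by (intro integral_mono_AE integrable_measure_pmf_finite finite_support)
       (auto simp: AE_measure_pmf_iff one)
  also have "\<dots> \<le> exp (l\<^sup>2 * M\<^sup>2 / 8) * exp (real n * (l\<^sup>2 * M\<^sup>2 / 8))"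
    using IH by simp
  also have "\<dots> = exp (real (Suc n) * (l\<^sup>2 * M\<^sup>2 / 8))"
    by (simp add: exp_add[symmetric] algebra_simps)
  finally show ?case by (simp add: mean)
qed

lemma tail_le:
  fixes f :: "'a \<Rightarrow> real"
  assumes l: "l > 0"
    and "\<And>x y. x \<in> set_pmf (\<mu> n) \<Longrightarrow> y \<in> set_pmf (\<mu> n) \<Longrightarrow> R x y \<Longrightarrow> \<bar>f x - f y\<bar> \<le> M"
  shows "measure_pmf.prob (\<mu> n) {x. f x - measure_pmf.expectation (\<mu> n) f \<ge> d}
           \<le> exp (real n * (l\<^sup>2 * M\<^sup>2 / 8) - l * d)"
proof -
  let ?Y = "\<lambda>x. f x - measure_pmf.expectation (\<mu> n) f"
  have "measure_pmf.prob (\<mu> n) {x. ?Y x \<ge> d}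
      \<le> exp (- l * d) * measure_pmf.expectation (\<mu> n) (\<lambda>x. exp (l * ?Y x))"
    using measure_pmf.Chernoff_ineq_ge[OF l, of "\<mu> n" UNIV ?Y d]
    by (simp add: set_integrable_def set_lebesgue_integral_def
          integrable_measure_pmf_finite[OF finite_support])
  also have "\<dots> \<le> exp (- l * d) * exp (real n * (l\<^sup>2 * M\<^sup>2 / 8))"
    by (intro mult_left_mono expectation_exp_le assms) auto
  finally show ?thesis by (simp add: exp_add[symmetric])
qed

lemma two_sided_tail_le:
  fixes f :: "'a \<Rightarrow> real"
  assumes l: "l > 0"
    and f: "\<And>x y. x \<in> set_pmf (\<mu> n) \<Longrightarrow> y \<in> set_pmf (\<mu> n) \<Longrightarrow> R x y \<Longrightarrow> \<bar>f x - f y\<bar> \<le> M"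
  shows "measure_pmf.prob (\<mu> n) {x. \<bar>f x - measure_pmf.expectation (\<mu> n) f\<bar> \<ge> d}
           \<le> 2 * exp (real n * (l\<^sup>2 * M\<^sup>2 / 8) - l * d)"
proof -
  let ?E = "measure_pmf.expectation (\<mu> n) f"
  have "{x. \<bar>f x - ?E\<bar> \<ge> d} = {x. f x - ?E \<ge> d} \<union> {x. - f x - (- ?E) \<ge> d}"
    by (auto simp: abs_real_def)
  then have "measure_pmf.prob (\<mu> n) {x. \<bar>f x - ?E\<bar> \<ge> d}
      \<le> measure_pmf.prob (\<mu> n) {x. f x - ?E \<ge> d} + measure_pmf.prob (\<mu> n) {x. - f x - (- ?E) \<ge> d}"
    by (simp add: measure_subadditive)
  moreover have "measure_pmf.prob (\<mu> n) {x. f x - ?E \<ge> d} \<le> exp (real n * (l\<^sup>2 * M\<^sup>2 / 8) - l * d)"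
    by (rule tail_le[OF l f])
  moreover have "measure_pmf.prob (\<mu> n) {x. - f x - (- ?E) \<ge> d} \<le> exp (real n * (l\<^sup>2 * M\<^sup>2 / 8) - l * d)"
    using tail_le[OF l, where f = "\<lambda>x. - f x"] f by (simp add: abs_minus_commute)
  ultimately show ?thesis by linarith
qed

end

section \<open>Multigraphs that differ by moved edge ends\<close>

text \<open>\<open>S\<close> collects the fixed ends of the edges whose other end moves from \<open>s\<close> to \<open>s'\<close>.\<close>

definition redirected :: "nat \<Rightarrow> nat \<Rightarrow> multigraph \<Rightarrow> multigraph \<Rightarrow> bool" where
  "redirected s s' G G' \<longleftrightarrow>
     (\<exists>K S. G = K + image_mset (\<lambda>x. {#x, s#}) S \<and> G' = K + image_mset (\<lambda>x. {#x, s'#}) S)"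

lemma deg_union: "deg (G + H) v = deg G v + deg H v"
  by (simp add: deg_def)

lemma deg_star: "deg (image_mset (\<lambda>x. {#x, s#}) S) v = count S v + (if v = s then size S else 0)"
  by (induction S) (auto simp: deg_add_mset deg_def[of "{#}"])

lemma deg_redirected:
  assumes "redirected s s' G G'" "v \<noteq> s" "v \<noteq> s'"
  shows "deg G v = deg G' v"
  using assms by (auto simp: redirected_def deg_union deg_star)

text \<open>Ends only leave \<open>s\<close>, so the surplus of attachment probability sits at
  \<open>s\<close>. This is the mass inequality that \<open>rel_pmf_move_mass\<close> asks
  for.\<close>

lemma deg_redirected_source_le:
  assumes "redirected s s' G G'"
  shows "deg G' s \<le> deg G s"
  using assms by (auto simp: redirected_def deg_union deg_star)

text \<open>Every edge with a moved end contains \<open>s\<close> or \<open>s'\<close>, so all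
  copies of \<open>e\<close> lie in the common part \<open>K\<close>.\<close>

lemma count_redirected:
  assumes "redirected s s' G G'" "s \<notin># e" "s' \<notin># e"
  shows "count G e = count G' e"
proof -
  have "count (image_mset (\<lambda>x. {#x, v#}) S) e = 0" if "v \<notin># e" for v S
    using that by (auto simp: count_eq_zero_iff)
  then show ?thesis using assms by (auto simp: redirected_def)
qed

text \<open>Relabelling acts on each edge end separately, so moved ends remain moved ends. If
  \<open>f\<close> merges \<open>s\<close> and \<open>s'\<close>, the two images coincide, which the
  relation permits.\<close>

lemma redirected_image:
  assumes "redirected s s' G G'"
  shows "redirected (f s) (f s') (image_mset (image_mset f) G) (image_mset (image_mset f) G')"
proof -
  obtain K S where "G = K + image_mset (\<lambda>x. {#x, s#}) S" "G' = K + image_mset (\<lambda>x. {#x, s'#}) S"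
    using assms by (auto simp: redirected_def)
  then show ?thesis unfolding redirected_def
    by (intro exI[of _ "image_mset (image_mset f) K"] exI[of _ "image_mset f S"])
       (simp add: multiset.map_comp o_def)
qed

lemma redirected_add_mset:
  "redirected s s' G G' \<Longrightarrow> redirected s s' (add_mset e G) (add_mset e G')"
  unfolding redirected_def by (metis union_mset_add_mset_left)

lemma redirected_add_mset_new:
  assumes "redirected s s' G G'"
  shows "redirected s s' (add_mset {#x, s#} G) (add_mset {#x, s'#} G')"
proof -
  obtain K S where "G = K + image_mset (\<lambda>x. {#x, s#}) S" "G' = K + image_mset (\<lambda>x. {#x, s'#}) S"
    using assms by (auto simp: redirected_def)
  then show ?thesis unfolding redirected_def
    by (intro exI[of _ K] exI[of _ "add_mset x S"]) simp
qed

lemma redirected_refl: "redirected s s' G G"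
  unfolding redirected_def by (intro exI[of _ G] exI[of _ "{#}"]) simp

section \<open>Stability of the edge count\<close>

text \<open>An edge at \<open>x\<close> determines its other end, so it is counted for at most one
  \<open>y\<close>, while it adds at least 1 to the degree of \<open>x\<close>.\<close>

lemma sum_count_le_deg:
  assumes "finite V"
  shows "(\<Sum>y\<in>V. count G {#x, y#}) \<le> deg G x"
proof (induction G)
  case empty
  then show ?case by simp
next
  case (add e G)
  have "(\<Sum>y\<in>V. if e = {#x, y#} then 1 else 0) = card {y \<in> V. e = {#x, y#}}"
    using assms by (simp add: sum.If_cases Int_def)
  also have "\<dots> \<le> count e x"
  proof (cases "\<exists>y. e = {#x, y#}")
    case True
    then obtain y where y: "e = {#x, y#}" by blast
    then have "{y \<in> V. e = {#x, y#}} \<subseteq> {y}" by auto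
    then have "card {y \<in> V. e = {#x, y#}} \<le> 1" by (metis card_mono finite.emptyI finite.insertI
        is_singletonI is_singleton_altdef)
    also have "1 \<le> count e x" using y by simp
    finally show ?thesis .
  qed simp
  finally have "(\<Sum>y\<in>V. if e = {#x, y#} then 1 else 0) \<le> count e x" .
  moreover have "(\<Sum>y\<in>V. count (add_mset e G) {#x, y#})
      = (\<Sum>y\<in>V. if e = {#x, y#} then 1 else 0) + (\<Sum>y\<in>V. count G {#x, y#})"
    unfolding sum.distrib[symmetric] by (rule sum.cong) auto
  ultimately show ?case using add by (simp add: deg_add_mset)
qed

abbreviation edge_pairs :: "nat \<Rightarrow> nat \<Rightarrow> nat \<Rightarrow> multigraph \<Rightarrow> (nat \<times> nat) set" where
  "edge_pairs d1 d2 t G \<equiv> {(x, y). x \<in> {1..t} \<and> y \<in> {1..t} \<and> x \<noteq> y \<and> deg G x = d1 \<and> deg G y = d2}"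

lemma finite_edge_pairs: "finite (edge_pairs d1 d2 t G)"
  by (rule finite_subset[of _ "{1..t} \<times> {1..t}"]) auto

text \<open>Such a pair has its first node in \<open>V d1\<close> or its second in
  \<open>V d2\<close>. Each of these sets has at most two nodes, and a node of degree
  \<open>d\<close> accounts for at most \<open>d\<close> edges.\<close>

lemma sum_edge_pairs_touching_le:
  "(\<Sum>(x, y)\<in>edge_pairs d1 d2 t G \<inter> {(x, y). x \<in> {s, s'} \<or> y \<in> {s, s'}}. count G {#x, y#})
     \<le> 2 * (d1 + d2)"
proof -
  define V where "V d = {v \<in> {s, s'}. deg G v = d}" for d
  have fV: "finite (V d)" for d by (simp add: V_def)
  have cV: "card (V d) \<le> 2" for d
  proof -
    have "card (V d) \<le> card {s, s'}" by (rule card_mono) (auto simp: V_def)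
    also have "\<dots> \<le> 2" by (simp add: card_insert_if)
    finally show ?thesis .
  qed
  have bound: "(\<Sum>(x, y)\<in>V d \<times> {1..t}. count G {#x, y#}) \<le> 2 * d" for d
  proof -
    have "(\<Sum>(x, y)\<in>V d \<times> {1..t}. count G {#x, y#}) = (\<Sum>x\<in>V d. \<Sum>y\<in>{1..t}. count G {#x, y#})"
      by (simp add: sum.cartesian_product)
    also have "\<dots> \<le> (\<Sum>x\<in>V d. deg G x)"
      by (intro sum_mono sum_count_le_deg) simp
    also have "\<dots> = card (V d) * d" by (simp add: V_def)
    also have "\<dots> \<le> 2 * d" using cV by (rule mult_le_mono1)
    finally show ?thesis .
  qed
  have swap: "(\<Sum>(x, y)\<in>{1..t} \<times> V d2. count G {#x, y#}) = (\<Sum>(x, y)\<in>V d2 \<times> {1..t}. count G {#x, y#})"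
    by (rule sum.reindex_bij_witness[of _ prod.swap prod.swap]) (auto simp: add_mset_commute)
  have "(\<Sum>(x, y)\<in>edge_pairs d1 d2 t G \<inter> {(x, y). x \<in> {s, s'} \<or> y \<in> {s, s'}}. count G {#x, y#})
      \<le> (\<Sum>(x, y)\<in>V d1 \<times> {1..t} \<union> {1..t} \<times> V d2. count G {#x, y#})"
    by (rule sum_mono2) (auto simp: fV V_def)
  also have "\<dots> \<le> (\<Sum>(x, y)\<in>V d1 \<times> {1..t}. count G {#x, y#}) + (\<Sum>(x, y)\<in>{1..t} \<times> V d2. count G {#x, y#})"
    using sum.union_inter[of "V d1 \<times> {1..t}" "{1..t} \<times> V d2" "\<lambda>(x, y). count G {#x, y#}"] fV
    by simp
  also have "\<dots> \<le> 2 * d1 + 2 * d2"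
    unfolding swap by (intro add_mono bound)
  finally show ?thesis by simp
qed

lemma num_edges_redirected:
  assumes "redirected s s' G G'"
  shows "\<bar>real (num_edges d1 d2 t G) - real (num_edges d1 d2 t G')\<bar> \<le> 2 * (real d1 + real d2)"
proof -
  let ?N = "{(x, y). x \<in> {s, s'} \<or> y \<in> {s, s'}}"
  let ?sum = "\<lambda>H A. \<Sum>(x, y)\<in>A. count H {#x, y#}"
  have split: "num_edges d1 d2 t H
      = ?sum H (edge_pairs d1 d2 t H \<inter> ?N) + ?sum H (edge_pairs d1 d2 t H - ?N)" for H
    unfolding num_edges_def by (rule sum.Int_Diff[OF finite_edge_pairs])
  \<comment> \<open>Away from \<open>s\<close> and \<open>s'\<close> degrees and multiplicities
    agree, so the remaining sums are equal and cancel.\<close>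
  have "edge_pairs d1 d2 t G - ?N = edge_pairs d1 d2 t G' - ?N"
    using deg_redirected[OF assms] by auto
  then have "?sum G (edge_pairs d1 d2 t G - ?N) = ?sum G' (edge_pairs d1 d2 t G' - ?N)"
  proof (rule sum.cong)
    fix z assume "z \<in> edge_pairs d1 d2 t G' - ?N"
    then have "count G {#fst z, snd z#} = count G' {#fst z, snd z#}"
      by (intro count_redirected[OF assms]) auto
    then show "(case z of (x, y) \<Rightarrow> count G {#x, y#}) = (case z of (x, y) \<Rightarrow> count G' {#x, y#})"
      by (simp add: case_prod_beta)
  qed
  \<comment> \<open>Both touching parts lie between 0 and the same bound, so their difference is at
    most that bound and not twice it.\<close>
  moreover have "\<bar>real (m + r) - real (n + r)\<bar> \<le> 2 * (real d1 + real d2)"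
    if "m \<le> 2 * (d1 + d2)" "n \<le> 2 * (d1 + d2)" for m n r :: nat
    using of_nat_mono[OF that(1), where 'a = real] of_nat_mono[OF that(2), where 'a = real]
    by (simp add: abs_le_iff)
  ultimately show ?thesis
    unfolding split[of G] split[of G'] by (simp only: sum_edge_pairs_touching_le)
qed

section \<open>The attachment process and its tail bound\<close>

text \<open>Time is shifted: state \<open>n\<close> of the chain is the graph on
  \<open>n + 1\<close> nodes, so that time 0 is the deterministic single loop. Step \<open>n\<close>
  therefore adds node \<open>n + 2\<close>.\<close>

definition BO1_step :: "real \<Rightarrow> nat \<Rightarrow> multigraph \<Rightarrow> multigraph pmf" where
  "BO1_step a n G =
     map_pmf (\<lambda>s. add_mset {#Suc (Suc n), s#} G) (attach_pmf a (Suc (Suc n)) G)"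

text \<open>Two outcomes of one step differ in one end of the new edge. In related graphs the new
  edges are coupled to be equal, or to end at \<open>s\<close> and at \<open>s'\<close>; in the
  latter case the new node joins \<open>S\<close>. The pair \<open>s\<close>, \<open>s'\<close> is
  bound existentially because it depends on the step at which the outcomes diverge.\<close>

lemma coupled_chain_BO1:
  assumes a: "a > 0"
  shows "coupled_chain (\<lambda>n. BO1 a (Suc n)) {# {#1, 1#} #} (BO1_step a)
           (\<lambda>G G'. \<exists>s s'. redirected s s' G G')"
proof unfold_locales
  fix n G assume G: "G \<in> set_pmf (BO1 a (Suc n))"
  have attach: "pmf (attach_pmf a (Suc (Suc n)) H) s = attach_prob a (Suc (Suc n)) H s"
    if "H \<in> set_pmf (BO1 a (Suc n))" for H s
    using pmf_attach_pmf[OF a, of "Suc (Suc n)" H] that by simp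
  have "set_pmf (attach_pmf a (Suc (Suc n)) G) \<subseteq> {1..Suc (Suc n)}"
    by (auto simp: set_pmf_iff attach[OF G] attach_prob_def split: if_splits)
  then show "finite (set_pmf (BO1_step a n G))"
    by (auto simp: BO1_step_def intro: finite_subset)
  show "\<exists>s s'. redirected s s' H H'"
    if "H \<in> set_pmf (BO1_step a n G)" "H' \<in> set_pmf (BO1_step a n G)" for H H'
    using that by (auto simp: BO1_step_def intro: redirected_add_mset_new redirected_refl)
  fix G' assume G': "G' \<in> set_pmf (BO1 a (Suc n))" and "\<exists>s s'. redirected s s' G G'"
  then obtain s s' where red: "redirected s s' G G'" by blast
  have D: "(a + 1) * real (Suc (Suc n)) - 1 > 0"
    using a by (simp add: algebra_simps add_pos_nonneg)
  have "rel_pmf (\<lambda>x y. x = y \<or> (x = s \<and> y = s'))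
      (attach_pmf a (Suc (Suc n)) G) (attach_pmf a (Suc (Suc n)) G')"
  \<comment> \<open>The normalising denominator depends on time only, so the two laws can differ
    only where the degrees do.\<close>
  proof (rule rel_pmf_move_mass)
    show "pmf (attach_pmf a (Suc (Suc n)) G) x = pmf (attach_pmf a (Suc (Suc n)) G') x"
      if "x \<noteq> s" "x \<noteq> s'" for x
      unfolding attach[OF G] attach[OF G'] attach_prob_def
      using deg_redirected[OF red that] by simp
    show "pmf (attach_pmf a (Suc (Suc n)) G') s \<le> pmf (attach_pmf a (Suc (Suc n)) G) s"
      unfolding attach[OF G] attach[OF G'] attach_prob_def
      using deg_redirected_source_le[OF red] D by (simp add: divide_right_mono)
  qed
  then show "rel_pmf (\<lambda>G G'. \<exists>s s'. redirected s s' G G') (BO1_step a n G) (BO1_step a n G')"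
    unfolding BO1_step_def pmf.rel_map
    by (rule pmf.rel_mono_strong)
       (use red in \<open>auto intro: redirected_add_mset redirected_add_mset_new\<close>)
qed (simp_all add: BO1_step_def[abs_def])

lemma num_edges_tail_le:
  fixes a c :: real and k d1 d2 t :: nat
  assumes a: "a > 0" and T: "k * t \<ge> 1" and d: "d1 + d2 \<ge> 1" and c: "c > 0"
  shows "measure_pmf.prob (BO a k t)
            {G. \<bar>real (num_edges d1 d2 t G) - expected_num_edges a k d1 d2 t\<bar>
                  \<ge> c * (real d1 + real d2) * sqrt (real k * real t)}
           \<le> 2 * exp (- (c\<^sup>2 / 2))"
proof -
  interpret coupled_chain "\<lambda>n. BO1 a (Suc n)" "{# {#1, 1#} #}" "BO1_step a"
    "\<lambda>G G'. \<exists>s s'. redirected s s' G G'"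
    by (rule coupled_chain_BO1[OF a])
  \<comment> \<open>Only \<open>k * t - 1\<close> steps are random, since the first loop is
    fixed.\<close>
  obtain n where n: "k * t = Suc n" using T by (cases "k * t") auto
  define D where "D = real d1 + real d2"
  have D: "D > 0" using d unfolding D_def by linarith
  define r where "r = sqrt (real k * real t)"
  have kt: "real k * real t = real (Suc n)" by (simp only: n[symmetric] of_nat_mult)
  have r: "r > 0" "r\<^sup>2 = real (Suc n)" unfolding r_def kt by simp_all
  \<comment> \<open>The identification of nodes is put into the statistic, so the chain remains the
    first-stage process; \<open>redirected_image\<close> carries the bound through.\<close>
  define f where "f G = real (num_edges d1 d2 t (image_mset (image_mset (block k)) G))" for G
  have f: "\<bar>f G - f G'\<bar> \<le> 2 * D" if "\<exists>s s'. redirected s s' G G'" for G G'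
    using that unfolding f_def D_def by (blast intro: num_edges_redirected redirected_image)
  \<comment> \<open>With \<open>M = 2 * D\<close> and \<open>r\<^sup>2\<close> steps the exponent is
    \<open>r\<^sup>2 * l\<^sup>2 * D\<^sup>2 / 2 - l * c * D * r\<close>; this \<open>l\<close>
    minimises it, with value \<open>- (c\<^sup>2 / 2)\<close>.\<close>
  define l where "l = c / (D * r)"
  have l: "l > 0" using c D r by (simp add: l_def)
  have mean: "expected_num_edges a k d1 d2 t = measure_pmf.expectation (BO1 a (Suc n)) f"
    by (simp add: expected_num_edges_def BO_def n f_def[abs_def] del: BO1.simps)
  have "measure_pmf.prob (BO a k t)
            {G. \<bar>real (num_edges d1 d2 t G) - expected_num_edges a k d1 d2 t\<bar> \<ge> c * D * r}
      = measure_pmf.prob (BO1 a (Suc n))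
            {G. \<bar>f G - measure_pmf.expectation (BO1 a (Suc n)) f\<bar> \<ge> c * D * r}"
    unfolding mean by (simp add: BO_def n f_def vimage_def del: BO1.simps)
  also have "\<dots> \<le> 2 * exp (real n * (l\<^sup>2 * (2 * D)\<^sup>2 / 8) - l * (c * D * r))"
    by (rule two_sided_tail_le[OF l f])
  also have "real n * (l\<^sup>2 * (2 * D)\<^sup>2 / 8) - l * (c * D * r) \<le> - (c\<^sup>2 / 2)"
  proof -
    have "l * (c * D * r) = c\<^sup>2"
      using D r by (simp add: l_def power2_eq_square)
    moreover have "real (Suc n) * (l\<^sup>2 * (2 * D)\<^sup>2 / 8) = c\<^sup>2 / 2"
      unfolding r(2)[symmetric] using D r(1) by (simp add: l_def power_divide power_mult_distrib)
    \<comment> \<open>Rounding the number of random steps up to \<open>k * t\<close> lets it cancel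
      against \<open>r\<^sup>2\<close>.\<close>
    moreover have "real n * (l\<^sup>2 * (2 * D)\<^sup>2 / 8) \<le> real (Suc n) * (l\<^sup>2 * (2 * D)\<^sup>2 / 8)"
      by (intro mult_right_mono) auto
    ultimately show ?thesis by linarith
  qed
  finally show ?thesis by (simp add: D_def r_def)
qed

theorem theorem4:
  fixes a :: real and k d1 d2 :: nat
  assumes "a > 0" and "k \<ge> 1" and "d1 \<ge> k" and "d2 \<ge> k"
  shows "(\<forall>t::nat. \<forall>c::real. t \<ge> 1 \<longrightarrow> c > 0 \<longrightarrow>
            measure_pmf.prob (BO a k t)
              {G. \<bar>real (num_edges d1 d2 t G) - expected_num_edges a k d1 d2 t\<bar>
                    \<ge> c * (real d1 + real d2) * sqrt (real k * real t)}
              \<le> 2 * exp (- (c\<^sup>2 / 8)))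
         \<and> (\<forall>c :: nat \<Rightarrow> real. filterlim c at_top sequentially \<longrightarrow>
            (\<lambda>t. measure_pmf.prob (BO a k t)
              {G. \<bar>real (num_edges d1 d2 t G) - expected_num_edges a k d1 d2 t\<bar>
                    < c t * (real d1 + real d2) * sqrt (real k * real t)})
              \<longlonglongrightarrow> 1)"
proof -
  let ?X = "\<lambda>t G. \<bar>real (num_edges d1 d2 t G) - expected_num_edges a k d1 d2 t\<bar>"
  let ?b = "\<lambda>c t. c * (real d1 + real d2) * sqrt (real k * real t)"
  have tail: "measure_pmf.prob (BO a k t) {G. ?X t G \<ge> ?b c t} \<le> 2 * exp (- (c\<^sup>2 / 8))"
    if "t \<ge> 1" "c > 0" for t and c :: real
  proof -
    have "measure_pmf.prob (BO a k t) {G. ?X t G \<ge> ?b c t} \<le> 2 * exp (- (c\<^sup>2 / 2))"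
      using assms that by (intro num_edges_tail_le) auto
    also have "\<dots> \<le> 2 * exp (- (c\<^sup>2 / 8))" by simp
    finally show ?thesis .
  qed
  have "(\<lambda>t. measure_pmf.prob (BO a k t) {G. ?X t G < ?b (c t) t}) \<longlonglongrightarrow> 1"
    if c: "filterlim c at_top sequentially" for c :: "nat \<Rightarrow> real"
  \<comment> \<open>The probability is squeezed between 1 and the complement of the tail bound at
    \<open>c t\<close>, which is available once \<open>c t\<close> is positive and
    \<open>t \<ge> 1\<close>.\<close>
  proof (rule tendsto_sandwich)
    have "filterlim (\<lambda>t. (c t)\<^sup>2) at_top sequentially"
      by (rule filterlim_pow_at_top[OF _ c]) simp
    then have "filterlim (\<lambda>t. 1 / 8 * (c t)\<^sup>2) at_top sequentially"
      by (intro filterlim_tendsto_pos_mult_at_top[OF tendsto_const]) simp_all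
    then have "(\<lambda>t. exp (- (1 / 8 * (c t)\<^sup>2))) \<longlonglongrightarrow> 0"
      by (intro filterlim_compose[OF exp_at_bot]) (simp add: filterlim_uminus_at_bot)
    then have "(\<lambda>t. 1 - 2 * exp (- (1 / 8 * (c t)\<^sup>2))) \<longlonglongrightarrow> 1 - 2 * 0"
      by (intro tendsto_intros)
    then show "(\<lambda>t. 1 - 2 * exp (- ((c t)\<^sup>2 / 8))) \<longlonglongrightarrow> 1" by simp
    have "\<forall>\<^sub>F t in sequentially. c t > 0"
      using c by (simp add: filterlim_at_top_dense)
    then show "\<forall>\<^sub>F t in sequentially.
        1 - 2 * exp (- ((c t)\<^sup>2 / 8)) \<le> measure_pmf.prob (BO a k t) {G. ?X t G < ?b (c t) t}"
      using eventually_ge_at_top[of 1]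
    proof eventually_elim
      case (elim t)
      have "{G. ?X t G < ?b (c t) t} = UNIV - {G. ?X t G \<ge> ?b (c t) t}" by auto
      then have "measure_pmf.prob (BO a k t) {G. ?X t G < ?b (c t) t}
          = 1 - measure_pmf.prob (BO a k t) {G. ?X t G \<ge> ?b (c t) t}"
        using measure_pmf.prob_compl[of "{G. ?X t G \<ge> ?b (c t) t}" "BO a k t"] by simp
      then show ?case using tail[OF elim(2,1)] by simp
    qed
  qed auto
  with tail show ?thesis by blast
qed

end
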